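(* The upper-sum order $\leq^{+}$ and the lower-sum order $\leq_{+}$ are the only total orders on $\mathbb{T}$ that are regular, compatible with the natural projection, and satisfy the weak law of trichotomy (WLT). (That is, a total order on $\mathbb{T}$ has these three properties if and only if it is $\leq^{+}$ or $\leq_{+}$.) Here $$(a_1,a,a_2)\leq^{+}(b_1,b,b_2)\iff\begin{cases}a<b,\ \text{or}\\ a=b\ \text{and}\ a_1+a_2<b_1+b_2,\ \text{or}\\ a=b\ \text{and}\ a_1+a_2=b_1+b_2\ \text{and}\ a_2\le b_2,\end{cases}$$ $$(a_1,a,a_2)\leq_{+}(b_1,b,b_2)\iff\begin{cases}a<b,\ \text{or}\\ a=b\ \text{and}\ a_1+a_2<b_1+b_2,\ \text{or}\\ a=b\ \text{and}\ a_1+a_2=b_1+b_2\ \text{and}\ a_1\le b_1.\end{cases}$$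
   Context: Triangular fuzzy numbers: $\mathbb{T}=\{(a_1,a,a_2)\in\mathbb{R}^3: a_1\le a\le a_2\}$. Each $t\in\mathbb{R}$ is identified with the scalar $(t,t,t)\in\mathbb{T}$; in particular $0=(0,0,0)$. Operations: $(a_1,a,a_2)+(b_1,b,b_2)=(a_1+b_1,a+b,a_2+b_2)$; for $t\in\mathbb{R}$, $t(a_1,a,a_2)=(ta_1,ta,ta_2)$ if $t\ge0$ and $(ta_2,ta,ta_1)$ if $t<0$; $-\alpha=(-1)\alpha$. A total order is total, reflexive, antisymmetric and transitive; $\alpha\prec\beta$ means $\alpha\preceq\beta$ and $\alpha\ne\beta$. $I_0=\{(-t,0,t): t\in\mathbb{R},\ t>0\}$. A regular order is one compatible with both arithmetic operations and MIN-MAX operators. Compatibility with arithmetic operations: $\alpha\preceq\beta$ implies $\alpha+\gamma\preceq\beta+\gamma$ for all $\gamma\in\mathbb{T}$, and $t\alpha\preceq t\beta$ for all real $t\ge0$. Compatibility with MIN-MAX operators: for all $\alpha,\beta\in\mathbb{T}$, if $MIN(\alpha,\beta)=\alpha$ then $\alpha\preceq\beta$. Here $\alpha=(a_1,a,a_2)$ is viewed as the membership function $\mathbb{R}\to[0,1]$ equal to $\frac{t-a_1}{a-a_1}$ on $[a_1,a)$, $1$ at $a$, $\frac{a_2-t}{a_2-a}$ on $(a,a_2]$, and $0$ elsewhere, and $MIN(\alpha,\beta)(z)=\sup_{z=\min\{x,y\}}\min\{\alpha(x),\beta(y)\}$. Equivalently (well known), for $\alpha=(a_1,a,a_2)$,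 $\beta=(b_1,b,b_2)$, $MIN(\alpha,\beta)=\alpha$ if and only if $a_1\le b_1$, $a\le b$ and $a_2\le b_2$. Natural projection: $\pi:\mathbb{T}\to\mathbb{R}$, $\pi(a_1,a,a_2)=a$. An order $\preceq$ is compatible with the natural projection if $\pi(\alpha)<\pi(\beta)$ implies $\alpha\prec\beta$. WLT: for every $\alpha\in\mathbb{T}\setminus I_0$, exactly one of the following holds: $\alpha=0$, $0\prec\alpha$, $0\prec-\alpha$. *)

theory Defs
  imports Complex_Main
begin

text \<open>Triangular fuzzy numbers \<open>(a\<^sub>1, a, a\<^sub>2)\<close>.\<close>

typedef tfn = "{(a1 :: real, a :: real, a2 :: real). a1 \<le> a \<and> a \<le> a2}"
  by (rule exI[of _ "(0, 0, 0)"]) simp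

setup_lifting type_definition_tfn

lift_definition left :: "tfn \<Rightarrow> real" is "\<lambda>(a1, a, a2). a1" .
lift_definition peak :: "tfn \<Rightarrow> real" is "\<lambda>(a1, a, a2). a" .
lift_definition right :: "tfn \<Rightarrow> real" is "\<lambda>(a1, a, a2). a2" .

lift_definition scalar :: "real \<Rightarrow> tfn" is "\<lambda>t. (t, t, t)"
  by simp

instantiation tfn :: "{zero, plus, scaleR, uminus}"
begin

definition zero_tfn :: tfn where
  "0 = scalar 0"

lift_definition plus_tfn :: "tfn \<Rightarrow> tfn \<Rightarrow> tfn" is
  "\<lambda>(a1, a, a2) (b1, b, b2). (a1 + b1, a + b, a2 + b2)"
  by auto

text \<open>Negative scalars swap the end points, so this is not a real vector space:
  \<open>\<alpha> + (- \<alpha>)\<close> is \<open>0\<close> only for scalar \<open>\<alpha>\<close>.\<close>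

lift_definition scaleR_tfn :: "real \<Rightarrow> tfn \<Rightarrow> tfn" is
  "\<lambda>t (a1, a, a2). if t \<ge> 0 then (t * a1, t * a, t * a2) else (t * a2, t * a, t * a1)"
  by (auto simp: mult_left_mono mult_left_mono_neg split: if_splits)

definition uminus_tfn :: "tfn \<Rightarrow> tfn" where
  "- \<alpha> = (-1) *\<^sub>R (\<alpha> :: tfn)"

instance ..

end

definition I0 :: "tfn set" where
  "I0 = {\<alpha>. \<exists>t>0. Rep_tfn \<alpha> = (- t, 0, t)}"

text \<open>The clause for the peak comes first because the peak may coincide with an end point.\<close>

definition membership :: "tfn \<Rightarrow> real \<Rightarrow> real" where
  "membership \<alpha> t =
    (if t = peak \<alpha> then 1
     else if left \<alpha> \<le> t \<and> t < peak \<alpha> then (t - left \<alpha>) / (peak \<alpha> - left \<alpha>)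
     else if peak \<alpha> < t \<and> t \<le> right \<alpha> then (right \<alpha> - t) / (right \<alpha> - peak \<alpha>)
     else 0)"

text \<open>The supremum is over a nonempty set of reals in \<open>[0, 1]\<close>, so it is the true supremum.
  The result is a function on the reals, not a priori the membership function of a \<^typ>\<open>tfn\<close>.\<close>

definition fuzzy_MIN :: "tfn \<Rightarrow> tfn \<Rightarrow> real \<Rightarrow> real" where
  "fuzzy_MIN \<alpha> \<beta> z = Sup {min (membership \<alpha> x) (membership \<beta> y) | x y. z = min x y}"

definition total_order :: "(tfn \<Rightarrow> tfn \<Rightarrow> bool) \<Rightarrow> bool" where
  "total_order le \<longleftrightarrow> totalp le \<and> reflp le \<and> antisymp le \<and> transp le"

definition strict :: "(tfn \<Rightarrow> tfn \<Rightarrow> bool) \<Rightarrow> tfn \<Rightarrow> tfn \<Rightarrow> bool" where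
  "strict le \<alpha> \<beta> \<longleftrightarrow> le \<alpha> \<beta> \<and> \<alpha> \<noteq> \<beta>"

definition arith_compatible :: "(tfn \<Rightarrow> tfn \<Rightarrow> bool) \<Rightarrow> bool" where
  "arith_compatible le \<longleftrightarrow>
    (\<forall>\<alpha> \<beta>. le \<alpha> \<beta> \<longrightarrow>
      (\<forall>\<gamma>. le (\<alpha> + \<gamma>) (\<beta> + \<gamma>)) \<and> (\<forall>t\<ge>0. le (t *\<^sub>R \<alpha>) (t *\<^sub>R \<beta>)))"

definition minmax_compatible :: "(tfn \<Rightarrow> tfn \<Rightarrow> bool) \<Rightarrow> bool" where
  "minmax_compatible le \<longleftrightarrow> (\<forall>\<alpha> \<beta>. fuzzy_MIN \<alpha> \<beta> = membership \<alpha> \<longrightarrow> le \<alpha> \<beta>)"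

definition regular :: "(tfn \<Rightarrow> tfn \<Rightarrow> bool) \<Rightarrow> bool" where
  "regular le \<longleftrightarrow> arith_compatible le \<and> minmax_compatible le"

definition projection_compatible :: "(tfn \<Rightarrow> tfn \<Rightarrow> bool) \<Rightarrow> bool" where
  "projection_compatible le \<longleftrightarrow> (\<forall>\<alpha> \<beta>. peak \<alpha> < peak \<beta> \<longrightarrow> strict le \<alpha> \<beta>)"

definition WLT :: "(tfn \<Rightarrow> tfn \<Rightarrow> bool) \<Rightarrow> bool" where
  "WLT le \<longleftrightarrow>
    (\<forall>\<alpha>. \<alpha> \<notin> I0 \<longrightarrow>
      (\<alpha> = 0 \<and> \<not> strict le 0 \<alpha> \<and> \<not> strict le 0 (- \<alpha>)) \<or>
      (\<alpha> \<noteq> 0 \<and> strict le 0 \<alpha> \<and> \<not> strict le 0 (- \<alpha>)) \<or>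
      (\<alpha> \<noteq> 0 \<and> \<not> strict le 0 \<alpha> \<and> strict le 0 (- \<alpha>)))"

definition upper_sum_le :: "tfn \<Rightarrow> tfn \<Rightarrow> bool" where
  "upper_sum_le \<alpha> \<beta> \<longleftrightarrow>
    peak \<alpha> < peak \<beta> \<or>
    peak \<alpha> = peak \<beta> \<and> left \<alpha> + right \<alpha> < left \<beta> + right \<beta> \<or>
    peak \<alpha> = peak \<beta> \<and> left \<alpha> + right \<alpha> = left \<beta> + right \<beta> \<and> right \<alpha> \<le> right \<beta>"

definition lower_sum_le :: "tfn \<Rightarrow> tfn \<Rightarrow> bool" where
  "lower_sum_le \<alpha> \<beta> \<longleftrightarrow>
    peak \<alpha> < peak \<beta> \<or>
    peak \<alpha> = peak \<beta> \<and> left \<alpha> + right \<alpha> < left \<beta> + right \<beta> \<or>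
    peak \<alpha> = peak \<beta> \<and> left \<alpha> + right \<alpha> = left \<beta> + right \<beta> \<and> left \<alpha> \<le> left \<beta>"

end

theory Submission imports Defs begin

text \<open>A compatible total order allows cancellation, so the comparison of two numbers with a common
  peak reduces either to a componentwise comparison, decided by MIN-MAX compatibility, or to the
  comparison of some \<open>\<delta> = (-u, 0, v)\<close> with \<open>0\<close>. If \<open>v < u\<close>, then \<open>\<delta> \<preceq> -\<delta>\<close> componentwise, so
  \<open>0 \<prec> \<delta>\<close> would give \<open>0 \<prec> -\<delta>\<close> as well, against WLT; hence the order refines the comparison of
  the sums of the end points. If \<open>u = v\<close>, then \<open>\<delta>\<close> is a multiple of \<open>(-1, 0, 1)\<close>, and the sign
  of this single element selects one of the two orders.\<close>

section \<open>Components of triangular fuzzy numbers\<close>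

lemma left_le_peak: "left \<alpha> \<le> peak \<alpha>"
  by transfer auto

lemma peak_le_right: "peak \<alpha> \<le> right \<alpha>"
  by transfer auto

lemma tfn_eqI: "left \<alpha> = left \<beta> \<Longrightarrow> peak \<alpha> = peak \<beta> \<Longrightarrow> right \<alpha> = right \<beta> \<Longrightarrow> \<alpha> = \<beta>"
  by transfer auto

lemma tfn_exists:
  assumes "l \<le> p" "p \<le> r"
  obtains \<alpha> where "left \<alpha> = l" "peak \<alpha> = p" "right \<alpha> = r"
proof -
  have "\<exists>\<alpha>. left \<alpha> = l \<and> peak \<alpha> = p \<and> right \<alpha> = r"
    using assms by transfer auto
  then show thesis using that by blast
qed

lemma components_zero [simp]: "left 0 = 0" "peak 0 = 0" "right 0 = 0"
  unfolding zero_tfn_def by (transfer, simp)+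

lemma components_plus [simp]:
  "left (\<alpha> + \<beta>) = left \<alpha> + left \<beta>"
  "peak (\<alpha> + \<beta>) = peak \<alpha> + peak \<beta>"
  "right (\<alpha> + \<beta>) = right \<alpha> + right \<beta>"
  by (transfer, auto)+

lemma components_scaleR:
  "left (t *\<^sub>R \<alpha>) = (if t \<ge> 0 then t * left \<alpha> else t * right \<alpha>)"
  "peak (t *\<^sub>R \<alpha>) = t * peak \<alpha>"
  "right (t *\<^sub>R \<alpha>) = (if t \<ge> 0 then t * right \<alpha> else t * left \<alpha>)"
  by (transfer, auto)+

lemma components_uminus [simp]:
  "left (- \<alpha>) = - right \<alpha>" "peak (- \<alpha>) = - peak \<alpha>" "right (- \<alpha>) = - left \<alpha>"
  unfolding uminus_tfn_def by (simp_all add: components_scaleR)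

lemma uminus_tfn_eq_zero_iff [simp]: "- \<alpha> = 0 \<longleftrightarrow> \<alpha> = 0" for \<alpha> :: tfn
proof
  assume "- \<alpha> = 0"
  from arg_cong[OF this, of left] arg_cong[OF this, of peak] arg_cong[OF this, of right]
  show "\<alpha> = 0" by (intro tfn_eqI) simp_all
qed (auto intro: tfn_eqI)

lemma mem_I0_iff: "\<alpha> \<in> I0 \<longleftrightarrow> peak \<alpha> = 0 \<and> left \<alpha> = - right \<alpha> \<and> 0 < right \<alpha>"
  unfolding I0_def by transfer auto

section \<open>The MIN operator\<close>

lemma membership_peak [simp]: "membership \<alpha> (peak \<alpha>) = 1"
  by (simp add: membership_def)

lemma membership_nonneg: "0 \<le> membership \<alpha> t"
  by (simp add: membership_def)

lemma membership_le_1: "membership \<alpha> t \<le> 1"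
  by (simp add: membership_def divide_simps)

lemma membership_eq_1_iff: "membership \<alpha> t = 1 \<longleftrightarrow> t = peak \<alpha>"
  by (auto simp: membership_def divide_simps)

lemma membership_eq_0: "t < left \<alpha> \<or> right \<alpha> < t \<Longrightarrow> membership \<alpha> t = 0"
  using left_le_peak[of \<alpha>] peak_le_right[of \<alpha>] by (auto simp: membership_def)

lemma membership_pos: "left \<alpha> < t \<Longrightarrow> t < right \<alpha> \<Longrightarrow> 0 < membership \<alpha> t"
  by (auto simp: membership_def)

lemma membership_antimono_right:
  assumes "peak \<alpha> \<le> s" "s \<le> t"
  shows "membership \<alpha> t \<le> membership \<alpha> s"
  using assms by (auto simp: membership_def divide_simps)

text \<open>On a flank, the membership value is x / (x + y), where x is the distance to the end
  point and y the distance to the peak. Cross-multiplication reduces the claim to x y' \<le> x'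
  y.\<close>

lemma quotient_mono:
  fixes x y x' y' :: real
  assumes "0 \<le> x" "x \<le> x'" "0 < y'" "y' \<le> y"
  shows "x / (x + y) \<le> x' / (x' + y')"
proof -
  have "x * y' \<le> x' * y"
    using assms by (intro mult_mono) auto
  then show ?thesis using assms by (simp add: frac_le_eq divide_simps algebra_simps)
qed

lemma membership_le_left_side:
  assumes "left \<alpha> \<le> left \<beta>" "peak \<alpha> \<le> peak \<beta>" "t \<le> peak \<alpha>"
  shows "membership \<beta> t \<le> membership \<alpha> t"
\<comment> \<open>In these two cases one of the values is extreme, namely 1 for \<alpha> or 0 for
  \<beta>. Otherwise t lies on both rising flanks and \<open>peak \<alpha> - t\<close> is positive,
  as \<open>quotient_mono\<close> demands.\<close>
proof (cases "t = peak \<alpha> \<or> t < left \<beta>")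
  case True
  then show ?thesis
    using membership_le_1 membership_nonneg membership_eq_0 by auto
next
  case False
  then show ?thesis
    using assms quotient_mono[of "t - left \<beta>" "t - left \<alpha>" "peak \<alpha> - t" "peak \<beta> - t"]
    by (auto simp: membership_def)
qed

lemma membership_le_right_side:
  assumes "peak \<alpha> \<le> peak \<beta>" "right \<alpha> \<le> right \<beta>" "peak \<beta> \<le> t"
  shows "membership \<alpha> t \<le> membership \<beta> t"
proof (cases "t = peak \<beta> \<or> right \<alpha> < t")
  case True
  then show ?thesis
    using membership_le_1 membership_nonneg membership_eq_0 by auto
next
  case False
  then show ?thesis
    using assms quotient_mono[of "right \<alpha> - t" "right \<beta> - t" "t - peak \<beta>" "t - peak \<alpha>"]
    by (auto simp: membership_def)
qed

section \<open>The equation MIN(\<alpha>, \<beta>) = \<alpha> in terms of components\<close>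

lemma fuzzy_MIN_ge:
  assumes "z = min x y"
  shows "min (membership \<alpha> x) (membership \<beta> y) \<le> fuzzy_MIN \<alpha> \<beta> z"
  unfolding fuzzy_MIN_def
proof (rule cSup_upper)
  show "bdd_above {min (membership \<alpha> x) (membership \<beta> y) |x y. z = min x y}"
    by (rule bdd_aboveI[of _ 1]) (auto simp: min_le_iff_disj membership_le_1)
qed (use assms in blast)

lemma fuzzy_MIN_le:
  assumes "\<And>x y. z = min x y \<Longrightarrow> min (membership \<alpha> x) (membership \<beta> y) \<le> c"
  shows "fuzzy_MIN \<alpha> \<beta> z \<le> c"
  unfolding fuzzy_MIN_def
proof (rule cSup_least)
  have "z = min z z" by simp
  then show "{min (membership \<alpha> x) (membership \<beta> y) |x y. z = min x y} \<noteq> {}"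
    by blast
qed (use assms in blast)

lemma fuzzy_MIN_eq_if_components_le:
  assumes "left \<alpha> \<le> left \<beta>" "peak \<alpha> \<le> peak \<beta>" "right \<alpha> \<le> right \<beta>"
  shows "fuzzy_MIN \<alpha> \<beta> = membership \<alpha>"
proof
  fix z
  have "fuzzy_MIN \<alpha> \<beta> z \<le> membership \<alpha> z"
  proof (rule fuzzy_MIN_le)
    fix x y assume z: "z = min x y"
    \<comment> \<open>If x is not the minimum, then either z is on the rising side of \<alpha>,
      where \<beta> lies below \<alpha>, or z is past the peak of \<alpha>, where \<alpha> decreases
      from z to x.\<close>
    then consider "x = z" | "y = z" "z \<le> x" "z \<le> peak \<alpha>" | "z \<le> x" "peak \<alpha> \<le> z"
      by linarith
    then show "min (membership \<alpha> x) (membership \<beta> y) \<le> membership \<alpha> z"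
      by cases (use membership_le_left_side[OF assms(1,2)] membership_antimono_right
          in \<open>auto simp: min_le_iff_disj\<close>)
  qed
  moreover have "membership \<alpha> z \<le> fuzzy_MIN \<alpha> \<beta> z"
  \<comment> \<open>The supremum is bounded below by the pair (z, \<open>peak \<beta>\<close>), at
    which \<beta> has the value 1, as long as z is the smaller entry; beyond that by (z, z), since
    \<beta> dominates \<alpha> there.\<close>
  proof (cases "z \<le> peak \<beta>")
    case True
    then show ?thesis
      using fuzzy_MIN_ge[of z z "peak \<beta>" \<alpha> \<beta>] membership_le_1[of \<alpha> z] by simp
  next
    case False
    then show ?thesis
      using fuzzy_MIN_ge[of z z z \<alpha> \<beta>] membership_le_right_side[OF assms(2,3), of z] by simp
  qed
  ultimately show "fuzzy_MIN \<alpha> \<beta> z = membership \<alpha> z" by simp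
qed

text \<open>Each inequality, if violated, yields a point at which MIN and \<alpha> differ. At
  \<open>peak \<beta>\<close>, MIN would be 1, a value that \<alpha> takes only at its own
  peak.\<close>

lemma components_le_if_fuzzy_MIN_eq:
  assumes eq: "fuzzy_MIN \<alpha> \<beta> = membership \<alpha>"
  shows "left \<alpha> \<le> left \<beta>" "peak \<alpha> \<le> peak \<beta>" "right \<alpha> \<le> right \<beta>"
proof -
  show peak: "peak \<alpha> \<le> peak \<beta>"
  proof (rule ccontr)
    assume less: "\<not> peak \<alpha> \<le> peak \<beta>"
    then have "1 \<le> membership \<alpha> (peak \<beta>)"
      using fuzzy_MIN_ge[of "peak \<beta>" "peak \<alpha>" "peak \<beta>" \<alpha> \<beta>] eq by simp
    with membership_le_1[of \<alpha> "peak \<beta>"] membership_eq_1_iff[of \<alpha> "peak \<beta>"] less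
    show False by simp
  qed
  show "left \<alpha> \<le> left \<beta>"
  proof (rule ccontr)
    assume "\<not> left \<alpha> \<le> left \<beta>"
    \<comment> \<open>Here \<alpha> vanishes, but the pair (\<open>peak \<alpha>\<close>, z) makes
      MIN positive.\<close>
    then obtain z where z: "left \<beta> < z" "z < left \<alpha>"
      using dense by (metis not_le)
    have "0 < membership \<beta> z"
      using z peak left_le_peak[of \<alpha>] peak_le_right[of \<beta>] by (intro membership_pos) auto
    moreover have "min (membership \<alpha> (peak \<alpha>)) (membership \<beta> z) \<le> membership \<alpha> z"
      using fuzzy_MIN_ge[of z "peak \<alpha>" z \<alpha> \<beta>] z left_le_peak[of \<alpha>] eq by simp
    ultimately show False
      using membership_eq_0[of z \<alpha>] z by (simp add: min_def split: if_splits)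
  qed
  show "right \<alpha> \<le> right \<beta>"
  proof (rule ccontr)
    assume "\<not> right \<alpha> \<le> right \<beta>"
    \<comment> \<open>Here \<alpha> is positive, but every pair with minimum z has its second entry
      beyond the support of \<beta>, so MIN vanishes.\<close>
    then obtain z where z: "right \<beta> < z" "z < right \<alpha>"
      using dense by (metis not_le)
    have "fuzzy_MIN \<alpha> \<beta> z \<le> 0"
    proof (rule fuzzy_MIN_le)
      fix x y assume "z = min x y"
      then have "right \<beta> < y" using z by linarith
      then show "min (membership \<alpha> x) (membership \<beta> y) \<le> 0"
        using membership_eq_0[of y \<beta>] by simp
    qed
    moreover have "0 < membership \<alpha> z"
      using z peak left_le_peak[of \<alpha>] peak_le_right[of \<beta>] by (intro membership_pos) auto
    ultimately show False using eq by simp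
  qed
qed

lemma fuzzy_MIN_eq_iff:
  "fuzzy_MIN \<alpha> \<beta> = membership \<alpha> \<longleftrightarrow>
    left \<alpha> \<le> left \<beta> \<and> peak \<alpha> \<le> peak \<beta> \<and> right \<alpha> \<le> right \<beta>"
  using fuzzy_MIN_eq_if_components_le components_le_if_fuzzy_MIN_eq by blast

section \<open>The two sum orders\<close>

lemma total_order_upper_sum_le: "total_order upper_sum_le"
  unfolding total_order_def
proof (intro conjI)
  show "antisymp upper_sum_le"
    by (rule antisympI, rule tfn_eqI) (auto simp: upper_sum_le_def)
qed (auto simp: upper_sum_le_def intro!: totalpI reflpI transpI)

lemma total_order_lower_sum_le: "total_order lower_sum_le"
  unfolding total_order_def
proof (intro conjI)
  show "antisymp lower_sum_le"
    by (rule antisympI, rule tfn_eqI) (auto simp: lower_sum_le_def)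
qed (auto simp: lower_sum_le_def intro!: totalpI reflpI transpI)

lemma arith_compatible_upper_sum_le: "arith_compatible upper_sum_le"
  unfolding arith_compatible_def
proof (intro allI impI conjI)
  fix \<alpha> \<beta> :: tfn and t :: real
  assume "upper_sum_le \<alpha> \<beta>" "0 \<le> t"
  then show "upper_sum_le (t *\<^sub>R \<alpha>) (t *\<^sub>R \<beta>)"
    \<comment> \<open>Scaling by 0 collapses strict inequalities to equalities, so it is treated
      apart; a positive factor cancels.\<close>
    by (cases "t = 0")
      (auto simp: upper_sum_le_def components_scaleR mult_le_cancel_left
        simp flip: distrib_left)
qed (auto simp: upper_sum_le_def)

lemma arith_compatible_lower_sum_le: "arith_compatible lower_sum_le"
  unfolding arith_compatible_def
proof (intro allI impI conjI)
  fix \<alpha> \<beta> :: tfn and t :: real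
  assume "lower_sum_le \<alpha> \<beta>" "0 \<le> t"
  then show "lower_sum_le (t *\<^sub>R \<alpha>) (t *\<^sub>R \<beta>)"
    by (cases "t = 0")
      (auto simp: lower_sum_le_def components_scaleR mult_le_cancel_left
        simp flip: distrib_left)
qed (auto simp: lower_sum_le_def)

lemma regular_upper_sum_le: "regular upper_sum_le"
  unfolding regular_def minmax_compatible_def fuzzy_MIN_eq_iff
  using arith_compatible_upper_sum_le by (auto simp: upper_sum_le_def)

lemma regular_lower_sum_le: "regular lower_sum_le"
  unfolding regular_def minmax_compatible_def fuzzy_MIN_eq_iff
  using arith_compatible_lower_sum_le by (auto simp: lower_sum_le_def)

lemma projection_compatible_upper_sum_le: "projection_compatible upper_sum_le"
  by (auto simp: projection_compatible_def strict_def upper_sum_le_def)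

lemma projection_compatible_lower_sum_le: "projection_compatible lower_sum_le"
  by (auto simp: projection_compatible_def strict_def lower_sum_le_def)

lemma not_mem_I0_cases:
  assumes "\<alpha> \<notin> I0"
  obtains "\<alpha> = 0" | "peak \<alpha> \<noteq> 0" | "peak \<alpha> = 0" "left \<alpha> + right \<alpha> \<noteq> 0"
proof -
  have "\<alpha> = 0" if "peak \<alpha> = 0" "left \<alpha> + right \<alpha> = 0"
    using that assms left_le_peak[of \<alpha>] peak_le_right[of \<alpha>]
    by (intro tfn_eqI) (auto simp: mem_I0_iff)
  then show thesis using that by blast
qed

text \<open>Negation reverses the signs of the peak and of the sum of the end points, so \<alpha>
  and -\<alpha> lie on opposite sides of 0. This serves both sum orders at once.\<close>

lemma WLT_if_refines_sum:
  assumes ord: "total_order le"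
    and peak: "\<And>\<alpha> \<beta>. peak \<alpha> < peak \<beta> \<Longrightarrow> le \<alpha> \<beta>"
    and sum: "\<And>\<alpha> \<beta>. peak \<alpha> = peak \<beta> \<Longrightarrow> left \<alpha> + right \<alpha> < left \<beta> + right \<beta> \<Longrightarrow> le \<alpha> \<beta>"
  shows "WLT le"
  unfolding WLT_def
proof (intro allI impI)
  fix \<alpha> assume "\<alpha> \<notin> I0"
  then have "\<alpha> = 0 \<or> \<alpha> \<noteq> 0 \<and> (le 0 \<alpha> \<and> le (- \<alpha>) 0 \<or> le \<alpha> 0 \<and> le 0 (- \<alpha>))"
  proof (cases rule: not_mem_I0_cases)
    case 2
    then show ?thesis
      using peak[of 0 \<alpha>] peak[of "- \<alpha>" 0] peak[of \<alpha> 0] peak[of 0 "- \<alpha>"]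
      by (cases "peak \<alpha>" "0 :: real" rule: linorder_cases) auto
  next
    case 3
    then show ?thesis
      using sum[of 0 \<alpha>] sum[of "- \<alpha>" 0] sum[of \<alpha> 0] sum[of 0 "- \<alpha>"]
      by (cases "left \<alpha> + right \<alpha>" "0 :: real" rule: linorder_cases) auto
  qed simp
  then show "\<alpha> = 0 \<and> \<not> strict le 0 \<alpha> \<and> \<not> strict le 0 (- \<alpha>) \<or>
    \<alpha> \<noteq> 0 \<and> strict le 0 \<alpha> \<and> \<not> strict le 0 (- \<alpha>) \<or>
    \<alpha> \<noteq> 0 \<and> \<not> strict le 0 \<alpha> \<and> strict le 0 (- \<alpha>)"
    using ord unfolding total_order_def strict_def by (metis antisympD uminus_tfn_eq_zero_iff)
qed

lemma WLT_upper_sum_le: "WLT upper_sum_le"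
  by (rule WLT_if_refines_sum[OF total_order_upper_sum_le]) (auto simp: upper_sum_le_def)

lemma WLT_lower_sum_le: "WLT lower_sum_le"
  by (rule WLT_if_refines_sum[OF total_order_lower_sum_le]) (auto simp: lower_sum_le_def)

section \<open>Uniqueness\<close>

text \<open>Totality turns a failure of \<open>le'\<close> into its converse, which the inclusion
  and antisymmetry refute. Uniqueness therefore needs only one inclusion.\<close>

lemma total_order_eqI:
  assumes "total_order le" "total_order le'" and sub: "\<And>\<alpha> \<beta>. le' \<alpha> \<beta> \<Longrightarrow> le \<alpha> \<beta>"
  shows "le = le'"
proof (intro ext iffI)
  fix \<alpha> \<beta> assume le: "le \<alpha> \<beta>"
  show "le' \<alpha> \<beta>"
  proof (rule ccontr)
    assume neg: "\<not> le' \<alpha> \<beta>"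
    then have "\<alpha> \<noteq> \<beta>" "le' \<beta> \<alpha>"
      using assms(2) unfolding total_order_def by (metis reflpD, metis reflpD totalpD)
    with le sub assms(1) show False
      unfolding total_order_def by (metis antisympD)
  qed
qed (rule sub)

context
  fixes le :: "tfn \<Rightarrow> tfn \<Rightarrow> bool"
  assumes total_order: "total_order le" and regular: "regular le"
    and proj: "projection_compatible le" and WLT: "WLT le"
begin

lemma le_total: "le \<alpha> \<beta> \<or> le \<beta> \<alpha>"
  using total_order unfolding total_order_def by (metis reflpD totalpD)

lemma le_trans: "le \<alpha> \<beta> \<Longrightarrow> le \<beta> \<gamma> \<Longrightarrow> le \<alpha> \<gamma>"
  using total_order unfolding total_order_def by (metis transpD)

lemma le_antisym: "le \<alpha> \<beta> \<Longrightarrow> le \<beta> \<alpha> \<Longrightarrow> \<alpha> = \<beta>"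
  using total_order unfolding total_order_def by (metis antisympD)

lemma le_plus: "le \<alpha> \<beta> \<Longrightarrow> le (\<alpha> + \<gamma>) (\<beta> + \<gamma>)"
  using regular unfolding regular_def arith_compatible_def by blast

lemma le_scaleR: "le \<alpha> \<beta> \<Longrightarrow> 0 \<le> t \<Longrightarrow> le (t *\<^sub>R \<alpha>) (t *\<^sub>R \<beta>)"
  using regular unfolding regular_def arith_compatible_def by blast

lemma le_if_components_le:
  "left \<alpha> \<le> left \<beta> \<Longrightarrow> peak \<alpha> \<le> peak \<beta> \<Longrightarrow> right \<alpha> \<le> right \<beta> \<Longrightarrow> le \<alpha> \<beta>"
  using regular unfolding regular_def minmax_compatible_def fuzzy_MIN_eq_iff by blast

section \<open>Comparison with 0 of elements with peak 0\<close>

lemma le_zero_if_sum_neg: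
  assumes "peak \<delta> = 0" "left \<delta> + right \<delta> < 0"
  shows "le \<delta> 0"
proof (rule ccontr)
  assume neg: "\<not> le \<delta> 0"
  then have pos: "le 0 \<delta>" using le_total by blast
  have "le \<delta> (- \<delta>)"
    using assms by (intro le_if_components_le) auto
  with pos have "le 0 (- \<delta>)" by (rule le_trans)
  moreover have "\<delta> \<noteq> 0" "- \<delta> \<noteq> 0" "\<delta> \<notin> I0"
    using assms by (auto simp: mem_I0_iff)
  ultimately show False
    using WLT pos unfolding WLT_def strict_def by metis
qed

text \<open>Compatibility covers only nonnegative scalars, so negating the previous case is not
  enough: it gives -\<delta> \<preceq> 0, and WLT is needed again to exclude 0 \<prec>
  -\<delta>.\<close>

lemma zero_le_if_sum_pos:
  assumes "peak \<delta> = 0" "0 < left \<delta> + right \<delta>"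
  shows "le 0 \<delta>"
proof (rule ccontr)
  assume neg: "\<not> le 0 \<delta>"
  have "le (- \<delta>) 0"
    using assms by (intro le_zero_if_sum_neg) auto
  moreover have "\<delta> \<noteq> 0" "\<delta> \<notin> I0"
    using assms by (auto simp: mem_I0_iff)
  then have "le 0 (- \<delta>)" "- \<delta> \<noteq> 0"
    using WLT neg unfolding WLT_def strict_def by metis+
  ultimately show False using le_antisym by blast
qed

lemma le_if_sum_less:
  assumes peak: "peak \<alpha> = peak \<beta>" and sum: "left \<alpha> + right \<alpha> < left \<beta> + right \<beta>"
  shows "le \<alpha> \<beta>"
proof -
  \<comment> \<open>In the last two cases one support contains the other in its interior. Only then
    is the componentwise difference, wider minus narrower, a triangular number with peak 0 and end
    points of strictly opposite sign.\<close>
  consider "left \<alpha> \<le> left \<beta>" "right \<alpha> \<le> right \<beta>"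
    | "left \<alpha> < left \<beta>" "right \<beta> < right \<alpha>" | "left \<beta> < left \<alpha>" "right \<alpha> < right \<beta>"
    using sum by linarith
  then show ?thesis
  proof cases
    case 1
    then show ?thesis using peak by (intro le_if_components_le) auto
  next
    case 2
    then obtain \<delta> where \<delta>: "left \<delta> = left \<alpha> - left \<beta>" "peak \<delta> = 0" "right \<delta> = right \<alpha> - right \<beta>"
      using tfn_exists[of "left \<alpha> - left \<beta>" 0 "right \<alpha> - right \<beta>"] by auto
    then have "le (\<delta> + \<beta>) (0 + \<beta>)"
      using sum by (intro le_plus le_zero_if_sum_neg) auto
    moreover have "\<delta> + \<beta> = \<alpha>" "0 + \<beta> = \<beta>"
      using \<delta> peak by (auto intro: tfn_eqI)
    ultimately show ?thesis by simp
  next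
    case 3
    then obtain \<delta> where \<delta>: "left \<delta> = left \<beta> - left \<alpha>" "peak \<delta> = 0" "right \<delta> = right \<beta> - right \<alpha>"
      using tfn_exists[of "left \<beta> - left \<alpha>" 0 "right \<beta> - right \<alpha>"] by auto
    then have "le (0 + \<alpha>) (\<delta> + \<alpha>)"
      using sum by (intro le_plus zero_le_if_sum_pos) auto
    moreover have "\<delta> + \<alpha> = \<beta>" "0 + \<alpha> = \<alpha>"
      using \<delta> peak by (auto intro: tfn_eqI)
    ultimately show ?thesis by simp
  qed
qed

lemma le_if_peak_less: "peak \<alpha> < peak \<beta> \<Longrightarrow> le \<alpha> \<beta>"
  using proj unfolding projection_compatible_def strict_def by blast

lemma le_eq_sum_order: "le = upper_sum_le \<or> le = lower_sum_le"
proof -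
  obtain \<iota> where \<iota>: "left \<iota> = -1" "peak \<iota> = 0" "right \<iota> = 1"
    using tfn_exists[of "-1" 0 1] by auto
  have scaleR_zero: "t *\<^sub>R (0 :: tfn) = 0" for t
    by (rule tfn_eqI) (auto simp: components_scaleR)
  have zero_plus: "0 + \<gamma> = \<gamma>" for \<gamma> :: tfn
    by (rule tfn_eqI) auto
  consider "le 0 \<iota>" | "le \<iota> 0" using le_total by blast
  then show ?thesis
  proof cases
    case 1
    have "le \<alpha> \<beta>" if "peak \<alpha> = peak \<beta>" "left \<alpha> + right \<alpha> = left \<beta> + right \<beta>" "right \<alpha> \<le> right \<beta>"
      for \<alpha> \<beta>
    proof -
      \<comment> \<open>Equal peaks and equal sums mean that \<beta> is \<alpha> widened
        symmetrically by this amount, that is, \<beta> =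
        \<open>?t *\<^sub>R \<iota> + \<alpha>\<close>.\<close>
      let ?t = "right \<beta> - right \<alpha>"
      have "le (?t *\<^sub>R 0 + \<alpha>) (?t *\<^sub>R \<iota> + \<alpha>)"
        using 1 that(3) by (intro le_plus le_scaleR) auto
      moreover have "?t *\<^sub>R \<iota> + \<alpha> = \<beta>"
        using that \<iota> by (intro tfn_eqI) (auto simp: components_scaleR)
      ultimately show ?thesis by (simp add: scaleR_zero zero_plus)
    qed
    then have "le = upper_sum_le"
      by (intro total_order_eqI[OF total_order total_order_upper_sum_le])
        (auto simp: upper_sum_le_def le_if_peak_less le_if_sum_less)
    then show ?thesis ..
  next
    case 2
    have "le \<alpha> \<beta>" if "peak \<alpha> = peak \<beta>" "left \<alpha> + right \<alpha> = left \<beta> + right \<beta>" "left \<alpha> \<le> left \<beta>"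
      for \<alpha> \<beta>
    proof -
      \<comment> \<open>Now \<alpha> is the wider number, and adding a multiple of \<iota> lowers an
        element.\<close>
      let ?t = "left \<beta> - left \<alpha>"
      have "le (?t *\<^sub>R \<iota> + \<beta>) (?t *\<^sub>R 0 + \<beta>)"
        using 2 that(3) by (intro le_plus le_scaleR) auto
      moreover have "?t *\<^sub>R \<iota> + \<beta> = \<alpha>"
        using that \<iota> by (intro tfn_eqI) (auto simp: components_scaleR)
      ultimately show ?thesis by (simp add: scaleR_zero zero_plus)
    qed
    then have "le = lower_sum_le"
      by (intro total_order_eqI[OF total_order total_order_lower_sum_le])
        (auto simp: lower_sum_le_def le_if_peak_less le_if_sum_less)
    then show ?thesis ..
  qed
qed

end

theorem theorem40:
  fixes le :: "tfn \<Rightarrow> tfn \<Rightarrow> bool"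
  shows "total_order le \<and> regular le \<and> projection_compatible le \<and> WLT le \<longleftrightarrow>
    le = upper_sum_le \<or> le = lower_sum_le"
  using le_eq_sum_order[of le]
    total_order_upper_sum_le regular_upper_sum_le projection_compatible_upper_sum_le WLT_upper_sum_le
    total_order_lower_sum_le regular_lower_sum_le projection_compatible_lower_sum_le WLT_lower_sum_le
  by blast

end
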